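(* Let $d\ge 1$ and let $r:\mathbb{R}^d\to\mathbb{R}^d\times\mathbb{R}^d$, $r(x)=(x,x)$. Let $X$ and $X'$ be random vectors in $\mathbb{R}^d$, each satisfying the following (with constants possibly depending on the vector): there exist $\rho>0$, $a>0$, $b>0$ such that for all $\lambda\in\mathbb{R}^d$, $\mathbb{E}[\exp(\lambda^\top X)]\le a\exp(b\|\lambda\|^\rho)$ (respectively with $X'$ in place of $X$). Let $\mathbb{Q}$ be the distribution of $\varepsilon=(\varepsilon^{(1)},\varepsilon^{(2)})$ and $\tilde{\mathbb{Q}}$ the distribution of $\tilde\varepsilon=(\tilde\varepsilon^{(1)},\tilde\varepsilon^{(2)})$, random vectors in $\mathbb{R}^d\times\mathbb{R}^d$ such that $\varepsilon^{(1)},\varepsilon^{(2)}$ are independent and $\tilde\varepsilon^{(1)},\tilde\varepsilon^{(2)}$ are independent. If $$\mathbb{P}_{r(X)}*\mathbb{Q}=\mathbb{P}_{r(X')}*\tilde{\mathbb{Q}},$$ then $\mathbb{P}_X=\mathbb{P}_{X'}$ and $\mathbb{Q}=\tilde{\mathbb{Q}}$ up to translation; that is, there exists $m\in\mathbb{R}^d$ such that $X'$ has the same distribution as $X+m$ and $\tilde{\mathbb{Q}}$ is the distribution of $\varepsilon-(m,m)$.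
   Context: $\|\cdot\|$ is the Euclidean norm, $\mathbb{P}_Z$ denotes the distribution of a random vector $Z$, and $*$ denotes convolution of probability measures, so that $\mathbb{P}_{r(X)}*\mathbb{Q}$ is the distribution of $Y=r(X)+\varepsilon$ with $X$ independent of $\varepsilon$ (repeated measurements model with two repetitions). *)

theory Defs
  imports "HOL-Probability.Probability"
begin

text \<open>Noise-free signal of the repeated measurements model with two repetitions:
  one draw of the random vector is recorded twice.\<close>

definition repeat_map :: "'v \<Rightarrow> 'v \<times> 'v" where
  "repeat_map x = (x, x)"

text \<open>Integrability is stated explicitly because the Bochner integral of a
  non-integrable function is 0, which would make the bound hold vacuously.\<close>

definition laplace_order_bounded :: "'s measure \<Rightarrow> ('s \<Rightarrow> real ^ 'd) \<Rightarrow> bool" where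
  "laplace_order_bounded M X \<longleftrightarrow>
    (\<exists>\<rho> a b :: real. \<rho> > 0 \<and> a > 0 \<and> b > 0 \<and>
      (\<forall>l :: real ^ 'd.
        integrable M (\<lambda>\<omega>. exp (l \<bullet> X \<omega>)) \<and>
        (\<integral>\<omega>. exp (l \<bullet> X \<omega>) \<partial>M) \<le> a * exp (b * norm l powr \<rho>)))"

end

theory Submission
  imports Defs "HOL-Complex_Analysis.Complex_Analysis"
begin

text \<open>In terms of characteristic functions the hypothesis reads
  \<open>\<phi>\<^bsub>X\<^esub>(s + t) \<phi>\<^bsub>1\<^esub>(s) \<phi>\<^bsub>2\<^esub>(t) = \<phi>\<^bsub>X'\<^esub>(s + t) \<phi>\<^bsub>1\<^esub>'(s) \<phi>\<^bsub>2\<^esub>'(t)\<close>.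
  On each line through the origin \<open>\<phi>\<^bsub>X\<^esub>\<close> and \<open>\<phi>\<^bsub>X'\<^esub>\<close> extend to entire functions \<open>F\<close> and \<open>G\<close>.
  Near the origin the noise factors do not vanish, so \<open>G / F\<close> is multiplicative there and hence
  \<open>G = F exp (c \<cdot>)\<close> everywhere by analytic continuation, with
  \<open>c = G'(0) - F'(0) = i (u \<bullet> m)\<close>, \<open>m = E X' - E X\<close>, on the line spanned by \<open>u\<close>. No joint analyticity in
  several variables is needed. Since the zeros of \<open>F\<close> are isolated, the factor \<open>\<phi>\<^bsub>X\<^esub>(s + t)\<close> can then be
  cancelled from the equation, which determines the noise.\<close>

section \<open>Entire functions\<close>

text \<open>Identity theorem: the real points just to the right of \<open>x\<close> accumulate at
  \<open>x\<close>. The punctured filter \<open>at x\<close> is enough, so nothing has to be known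
  at \<open>x\<close> itself.\<close>

lemma holomorphic_eq_zero_if_zero_on_reals:
  assumes f: "f holomorphic_on UNIV"
    and ev: "eventually (\<lambda>r::real. f (of_real r) = 0) (at x)"
  shows "f z = 0"
proof -
  obtain d where d: "d > 0" "\<And>r. r \<noteq> x \<Longrightarrow> dist r x < d \<Longrightarrow> f (of_real r) = 0"
    using ev unfolding eventually_at by blast
  let ?U = "of_real ` {x<..<x+d} :: complex set"
  have "of_real x islimpt ?U"
    unfolding islimpt_approachable
  proof (intro allI impI)
    fix e :: real assume "e > 0"
    let ?y = "x + min d e / 2"
    have "?y \<in> {x<..<x+d}" using \<open>e > 0\<close> d(1) by (auto simp: min_def field_simps)
    moreover have "dist (of_real ?y :: complex) (of_real x) < e"
      using \<open>e > 0\<close> d(1) by (simp add: dist_norm min_def flip: of_real_diff of_real_add)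
    moreover have "?y \<noteq> x" using \<open>e > 0\<close> d(1) by auto
    ultimately show "\<exists>x'\<in>?U. x' \<noteq> of_real x \<and> dist x' (of_real x) < e"
      by (intro bexI[of _ "of_real ?y"]) (auto simp del: of_real_add)
  qed
  moreover have "f y = 0" if "y \<in> ?U" for y
    using that d(2) by (auto simp: dist_real_def)
  ultimately show ?thesis
    using analytic_continuation[OF f, of ?U "of_real x" z] by auto
qed

text \<open>Setting \<open>t = 0\<close> or \<open>s = 0\<close> expresses the ratios of the noise
  factors through \<open>F\<close> and \<open>G\<close>. Feeding them back into the equation removes
  the noise and makes \<open>G / F\<close> multiplicative near \<open>0\<close>. Differentiating
  gives the linear equation \<open>F G' - G F' = c F G\<close>, whose solution is the exponential.
  The noise factors live on the real line only and need no regularity beyond being nonzero near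
  \<open>0\<close>.\<close>

lemma entire_factorization_eq:
  fixes F G :: "complex \<Rightarrow> complex" and \<alpha> \<beta> \<alpha>' \<beta>' :: "real \<Rightarrow> complex"
  assumes F: "F holomorphic_on UNIV" "F 0 = 1" and G: "G holomorphic_on UNIV" "G 0 = 1"
    and ev: "eventually (\<lambda>s. \<alpha> s \<noteq> 0 \<and> \<beta> s \<noteq> 0 \<and> \<alpha>' s \<noteq> 0 \<and> \<beta>' s \<noteq> 0) (nhds 0)"
    and one: "\<alpha> 0 = 1" "\<beta> 0 = 1" "\<alpha>' 0 = 1" "\<beta>' 0 = 1"
    and eq: "\<And>s t :: real. F (of_real (s + t)) * \<alpha> s * \<beta> t = G (of_real (s + t)) * \<alpha>' s * \<beta>' t"
  shows "G z = F z * exp ((deriv G 0 - deriv F 0) * z)"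
proof -
  define c where "c = deriv G 0 - deriv F 0"
  have ev': "eventually (\<lambda>s. \<alpha> s \<noteq> 0 \<and> \<beta> s \<noteq> 0 \<and> \<alpha>' s \<noteq> 0 \<and> \<beta>' s \<noteq> 0) (at 0)"
    using ev by (simp add: eventually_nhds_conv_at)
  have derF: "(F has_field_derivative deriv F w) (at w)" for w
    using F(1) by (auto intro: holomorphic_derivI)
  have derG: "(G has_field_derivative deriv G w) (at w)" for w
    using G(1) by (auto intro: holomorphic_derivI)
  \<comment> \<open>Multiplicativity of \<open>G / F\<close>, cross-multiplied because
    \<open>F\<close> and \<open>G\<close> may vanish; only noise factors are cancelled.\<close>
  have small: "F (of_real s) * F (of_real t) * G (of_real (s + t))
      = G (of_real s) * G (of_real t) * F (of_real (s + t))"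
    if s: "\<alpha> s \<noteq> 0" "\<alpha>' s \<noteq> 0" and t: "\<beta> t \<noteq> 0" "\<beta>' t \<noteq> 0" for s t
  proof -
    have 1: "F (of_real s) * \<alpha> s = G (of_real s) * \<alpha>' s" using eq[of s 0] one by simp
    have 2: "F (of_real t) * \<beta> t = G (of_real t) * \<beta>' t" using eq[of 0 t] one by simp
    have "F (of_real s) * F (of_real t) * G (of_real (s + t)) * (\<alpha> s * \<beta> t * \<alpha>' s * \<beta>' t)
      = (F (of_real s) * \<alpha> s) * (F (of_real t) * \<beta> t) * (G (of_real (s + t)) * \<alpha>' s * \<beta>' t)"
      by (simp only: mult_ac)
    also have "\<dots> = (G (of_real s) * \<alpha>' s) * (G (of_real t) * \<beta>' t) * (F (of_real (s + t)) * \<alpha> s * \<beta> t)"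
      by (simp only: 1 2 eq)
    also have "\<dots> = G (of_real s) * G (of_real t) * F (of_real (s + t)) * (\<alpha> s * \<beta> t * \<alpha>' s * \<beta>' t)"
      by (simp only: mult_ac)
    finally show ?thesis using s t by simp
  qed
  have ode_small: "F (of_real s) * deriv G (of_real s) - G (of_real s) * deriv F (of_real s)
      - c * F (of_real s) * G (of_real s) = 0"
    if s: "\<alpha> s \<noteq> 0" "\<alpha>' s \<noteq> 0" for s
  proof -
    \<comment> \<open>With \<open>s\<close> fixed, \<open>H\<close> is the relation
      \<open>small\<close> with \<open>t\<close> replaced by a complex variable. It vanishes for
      small real \<open>t\<close>, hence identically, and \<open>H'(0) = 0\<close> is the claim
      because \<open>F 0 = G 0 = 1\<close>.\<close>
    define H where "H = (\<lambda>w. F (of_real s) * F w * G (of_real s + w) - G (of_real s) * G w * F (of_real s + w))"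
    have shift: "(\<lambda>w. f (of_real s + w)) holomorphic_on UNIV" if "f holomorphic_on UNIV" for f :: "complex \<Rightarrow> complex"
    proof -
      have "(\<lambda>w. of_real s + w) holomorphic_on UNIV" by (intro holomorphic_intros)
      from holomorphic_on_compose[OF this, of f] show ?thesis
        using holomorphic_on_subset[OF that] by (simp add: comp_def)
    qed
    have "H holomorphic_on UNIV" unfolding H_def
      using F(1) G(1) shift[OF F(1)] shift[OF G(1)]
      by (intro holomorphic_on_diff holomorphic_on_mult holomorphic_on_const)
    moreover have "eventually (\<lambda>t. H (of_real t) = 0) (at 0)"
      using ev' by eventually_elim (auto simp: H_def small[OF s, simplified])
    ultimately have "H w = 0" for w
      by (rule holomorphic_eq_zero_if_zero_on_reals)
    then have "H = (\<lambda>w. 0)" by auto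
    moreover have derF': "((\<lambda>w. F (of_real s + w)) has_field_derivative deriv F (of_real s)) (at 0)"
      using derF[of "of_real s"] DERIV_shift[of F "deriv F (of_real s)" 0 "of_real s"] by (simp add: add.commute)
    moreover have derG': "((\<lambda>w. G (of_real s + w)) has_field_derivative deriv G (of_real s)) (at 0)"
      using derG[of "of_real s"] DERIV_shift[of G "deriv G (of_real s)" 0 "of_real s"] by (simp add: add.commute)
    have "(H has_field_derivative
        (F (of_real s) * deriv F 0 * G (of_real s) + F (of_real s) * F 0 * deriv G (of_real s)
        - (G (of_real s) * deriv G 0 * F (of_real s) + G (of_real s) * G 0 * deriv F (of_real s)))) (at 0)"
      unfolding H_def
      by (rule derivative_eq_intros derF derG derF' derG' refl)+ (simp add: algebra_simps)
    ultimately have "F (of_real s) * deriv F 0 * G (of_real s) + F (of_real s) * F 0 * deriv G (of_real s)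
        - (G (of_real s) * deriv G 0 * F (of_real s) + G (of_real s) * G 0 * deriv F (of_real s)) = 0"
      by (metis DERIV_const DERIV_unique)
    then show ?thesis by (simp add: F(2) G(2) c_def algebra_simps)
  qed
  \<comment> \<open>A second continuation, now in the variable \<open>s\<close>.\<close>
  have ode: "F w * deriv G w - G w * deriv F w - c * F w * G w = 0" for w
  proof (rule holomorphic_eq_zero_if_zero_on_reals[where x = 0
        and f = "\<lambda>w. F w * deriv G w - G w * deriv F w - c * F w * G w"])
    show "(\<lambda>w. F w * deriv G w - G w * deriv F w - c * F w * G w) holomorphic_on UNIV"
      using F(1) G(1) by (auto intro!: holomorphic_intros holomorphic_deriv)
    show "eventually (\<lambda>r::real. F (of_real r) * deriv G (of_real r) - G (of_real r) * deriv F (of_real r)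
        - c * F (of_real r) * G (of_real r) = 0) (at 0)"
      using ev' by eventually_elim (blast intro: ode_small)
  qed
  \<comment> \<open>\<open>F\<close> may have zeros elsewhere, so the quotient is formed only on a
    ball around \<open>0\<close>; the identity theorem later leads from the ball to the whole
    plane.\<close>
  have "continuous (at 0) F" using derF DERIV_isCont by blast
  then have "eventually (\<lambda>w. F w \<noteq> 0) (nhds 0)"
    using F(2) by (auto simp: continuous_at eventually_nhds_conv_at intro: tendsto_imp_eventually_ne)
  then obtain e where e: "e > 0" "\<And>w. dist w 0 < e \<Longrightarrow> F w \<noteq> 0"
    unfolding eventually_nhds_metric by blast
  have ball: "G w = F w * exp (c * w)" if w: "w \<in> ball 0 e" for w
  proof -
    \<comment> \<open>The derivative of \<open>q\<close> is a multiple of the left-hand side of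
      \<open>ode\<close>, so \<open>q\<close> is constant with value \<open>q 0 = 1\<close>.\<close>
    define q where "q = (\<lambda>w. G w * exp (- (c * w)) / F w)"
    have der: "(q has_field_derivative 0) (at w within ball 0 e)" if "w \<in> ball 0 e" for w
    proof -
      have ne: "F w \<noteq> 0" using that e(2) by (simp add: dist_commute)
      have "(q has_field_derivative
          ((deriv G w * exp (- (c * w)) + G w * (- c * exp (- (c * w)))) * F w - G w * exp (- (c * w)) * deriv F w)
          / (F w * F w)) (at w)"
        unfolding q_def
        by (rule derivative_eq_intros derF derG refl ne)+ (simp add: algebra_simps)
      moreover have "(deriv G w * exp (- (c * w)) + G w * (- c * exp (- (c * w)))) * F w - G w * exp (- (c * w)) * deriv F w
        = exp (- (c * w)) * (F w * deriv G w - G w * deriv F w - c * F w * G w)"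
        by (simp add: algebra_simps)
      ultimately show ?thesis by (simp add: ode has_field_derivative_at_within)
    qed
    obtain k where k: "\<And>w. w \<in> ball 0 e \<Longrightarrow> q w = k"
      using has_field_derivative_zero_constant[OF convex_ball, of 0 e q] der by blast
    have "q w = q 0" using k w e(1) by simp
    also have "q 0 = 1" by (simp add: q_def F(2) G(2))
    finally show ?thesis
      using e(2)[of w] w by (simp add: q_def field_simps exp_minus)
  qed
  have "G z - F z * exp (c * z) = 0"
  proof (rule holomorphic_eq_zero_if_zero_on_reals[where x = 0 and f = "\<lambda>z. G z - F z * exp (c * z)"])
    show "(\<lambda>z. G z - F z * exp (c * z)) holomorphic_on UNIV"
      using F(1) G(1) by (auto intro!: holomorphic_intros)
    show "eventually (\<lambda>r::real. G (of_real r) - F (of_real r) * exp (c * of_real r) = 0) (at 0)"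
      unfolding eventually_at using e(1) ball by (intro exI[of _ e]) (auto simp: dist_norm)
  qed
  then show ?thesis by (simp add: c_def)
qed

section \<open>Entire extension of a characteristic function under exponential moments\<close>

lemma power_div_fact_le_exp:
  fixes x :: real assumes "x \<ge> 0"
  shows "x ^ n / fact n \<le> exp x"
proof -
  have "(\<Sum>k\<in>{n}. x ^ k /\<^sub>R fact k) \<le> (\<Sum>k. x ^ k /\<^sub>R fact k)"
    using assms summable_exp_generic[of x] by (intro sum_le_suminf) auto
  then show ?thesis by (simp add: exp_def divide_inverse mult.commute)
qed

text \<open>The exponential series in \<open>z\<close> is integrated term by term, with
  \<open>exp (norm z * \<bar>Y \<omega>\<bar>)\<close> as integrable majorant. The result is a power
  series converging everywhere, which gives holomorphy, and its linear coefficient is \<i> times the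
  mean.\<close>

lemma
  fixes M :: "'a measure" and Y :: "'a \<Rightarrow> real"
  assumes M: "finite_measure M" and Y[measurable]: "Y \<in> borel_measurable M"
    and int: "\<And>l. integrable M (\<lambda>\<omega>. exp (l * Y \<omega>))"
  shows integrable_if_exp_moments: "integrable M Y"
    and holomorphic_complex_mgf: "(\<lambda>z. CLINT \<omega>|M. exp (\<i> * z * of_real (Y \<omega>))) holomorphic_on UNIV"
    and deriv_complex_mgf: "deriv (\<lambda>z. CLINT \<omega>|M. exp (\<i> * z * of_real (Y \<omega>))) 0 = \<i> * of_real (LINT \<omega>|M. Y \<omega>)"
proof -
  interpret finite_measure M by fact
  define F where "F = (\<lambda>z. CLINT \<omega>|M. exp (\<i> * z * of_real (Y \<omega>)))"
  define c where "c = (\<lambda>n. CLINT \<omega>|M. (\<i> * of_real (Y \<omega>)) ^ n / fact n)"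
  \<comment> \<open>One of the two summands in the majorant below equals
    \<open>exp (r * \<bar>Y \<omega>\<bar>)\<close>, according to the sign of
    \<open>Y \<omega>\<close>.\<close>
  have intabs: "integrable M (\<lambda>\<omega>. exp (r * \<bar>Y \<omega>\<bar>))" for r
  proof (rule Bochner_Integration.integrable_bound)
    show "integrable M (\<lambda>\<omega>. exp (r * Y \<omega>) + exp ((- r) * Y \<omega>))"
      by (intro Bochner_Integration.integrable_add int)
    show "AE \<omega> in M. norm (exp (r * \<bar>Y \<omega>\<bar>)) \<le> norm (exp (r * Y \<omega>) + exp ((- r) * Y \<omega>))"
    proof (intro AE_I2)
      fix \<omega>
      have "exp (r * \<bar>Y \<omega>\<bar>) \<le> exp (r * Y \<omega>) + exp ((- r) * Y \<omega>)" by (simp add: abs_if)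
      then show "norm (exp (r * \<bar>Y \<omega>\<bar>)) \<le> norm (exp (r * Y \<omega>) + exp ((- r) * Y \<omega>))" by simp
    qed
  qed measurable
  have intpow: "integrable M (\<lambda>\<omega>. (\<bar>Y \<omega>\<bar> ^ n / fact n))" for n
    by (rule Bochner_Integration.integrable_bound[OF intabs[of 1]]) (auto simp: power_div_fact_le_exp)
  show intY: "integrable M Y"
    by (rule Bochner_Integration.integrable_bound[OF intpow[of 1]]) auto
  have nrm: "norm ((\<i> * z * of_real (Y \<omega>)) ^ n / fact n) = norm z ^ n * (\<bar>Y \<omega>\<bar> ^ n / fact n)" for z \<omega> n
    by (simp add: norm_mult norm_divide norm_power power_mult_distrib)
  have sums: "(\<lambda>n. c n * z ^ n) sums F z" for z
  proof -
    let ?f = "\<lambda>n \<omega>. (\<i> * z * of_real (Y \<omega>)) ^ n / fact n"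
    have I: "integrable M (?f n)" for n
      by (rule Bochner_Integration.integrable_bound[OF integrable_mult_right[OF intpow[of n], of "norm z ^ n"]])
        (auto simp: norm_mult norm_divide norm_power power_mult_distrib)
    have ex: "?f n \<omega> = (\<i> * z * of_real (Y \<omega>)) ^ n /\<^sub>R fact n" for n \<omega>
      by (simp add: scaleR_conv_of_real divide_inverse mult.commute)
    have sn: "(\<lambda>n. norm (?f n \<omega>)) sums exp (norm z * \<bar>Y \<omega>\<bar>)" for \<omega>
      using exp_converges[of "norm z * \<bar>Y \<omega>\<bar>"]
      by (simp only: nrm) (simp add: power_mult_distrib divide_inverse mult_ac)
    have "(\<lambda>n. integral\<^sup>L M (?f n)) sums (CLINT \<omega>|M. (\<Sum>n. ?f n \<omega>))"
    proof (rule sums_integral[OF I])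
      show "AE \<omega> in M. summable (\<lambda>n. norm (?f n \<omega>))"
        using sn sums_summable by blast
      \<comment> \<open>The terms are nonnegative, and all partial sums stay below the integral of
        the majorant.\<close>
      show "summable (\<lambda>n. LINT \<omega>|M. norm (?f n \<omega>))"
      proof (rule summableI_nonneg_bounded)
        fix N
        have "(\<Sum>n<N. LINT \<omega>|M. norm (?f n \<omega>)) = (LINT \<omega>|M. (\<Sum>n<N. norm (?f n \<omega>)))"
          by (rule Bochner_Integration.integral_sum[symmetric]) (rule integrable_norm[OF I])
        also have "\<dots> \<le> (LINT \<omega>|M. exp (norm z * \<bar>Y \<omega>\<bar>))"
        proof (rule integral_mono)
          show "integrable M (\<lambda>\<omega>. \<Sum>n<N. norm (?f n \<omega>))"
            by (intro Bochner_Integration.integrable_sum integrable_norm I)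
          show "(\<Sum>n<N. norm (?f n \<omega>)) \<le> exp (norm z * \<bar>Y \<omega>\<bar>)" for \<omega>
            using sn[of \<omega>] sum_le_suminf[of "\<lambda>n. norm (?f n \<omega>)" "{..<N}"] by (simp add: sums_iff)
        qed (rule intabs)
        finally show "(\<Sum>n<N. LINT \<omega>|M. norm (?f n \<omega>)) \<le> (LINT \<omega>|M. exp (norm z * \<bar>Y \<omega>\<bar>))" .
      qed auto
    qed
    moreover have "(\<Sum>n. ?f n \<omega>) = exp (\<i> * z * of_real (Y \<omega>))" for \<omega>
      unfolding ex exp_def ..
    moreover have "integral\<^sup>L M (?f n) = c n * z ^ n" for n
    proof -
      have "?f n \<omega> = (\<i> * of_real (Y \<omega>)) ^ n / fact n * z ^ n" for \<omega>
        by (simp add: power_mult_distrib mult_ac)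
      then show ?thesis unfolding c_def by (simp only: integral_mult_left_zero)
    qed
    ultimately show ?thesis by (simp add: F_def)
  qed
  have Feq: "F = (\<lambda>z. \<Sum>n. c n * z ^ n)"
    using sums by (auto simp: sums_iff)
  have der: "(F has_field_derivative (\<Sum>n. diffs c n * z ^ n)) (at z)" for z
    unfolding Feq by (rule termdiffs_strong_converges_everywhere) (use sums sums_summable in blast)
  then show "F holomorphic_on UNIV"
    by (auto simp: holomorphic_on_def field_differentiable_def intro: has_field_derivative_at_within)
  \<comment> \<open>At \<open>0\<close> only the constant term \<open>diffs c 0 = c 1\<close> of the
    differentiated series survives.\<close>
  have "deriv F 0 = c 1"
    using der[of 0] by (intro DERIV_imp_deriv) (simp add: diffs_def)
  also have "c 1 = \<i> * of_real (LINT \<omega>|M. Y \<omega>)"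
    using intY by (simp add: c_def)
  finally show "deriv F 0 = \<i> * of_real (LINT \<omega>|M. Y \<omega>)" .
qed

section \<open>Characteristic functions on Euclidean spaces\<close>

text \<open>Levy's theorem concerns probability measures. The value of \<open>char\<close> at
  \<open>0\<close> is the total mass, so both masses equal some \<open>c\<close>; for
  \<open>c > 0\<close> both measures are rescaled by \<open>1 / c\<close>, and for
  \<open>c = 0\<close> both are null. The version for finite measures is needed because the weighted
  laws used below are not normalised.\<close>

lemma char_eq_imp_eq_finite:
  fixes \<mu> \<nu> :: "real measure"
  assumes fin: "finite_measure \<mu>" "finite_measure \<nu>"
    and sets[measurable_cong]: "sets \<mu> = sets borel" "sets \<nu> = sets borel"
    and char: "char \<mu> = char \<nu>"
  shows "\<mu> = \<nu>"
proof -
  interpret \<mu>: finite_measure \<mu> by fact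
  interpret \<nu>: finite_measure \<nu> by fact
  have sp: "space \<mu> = UNIV" "space \<nu> = UNIV"
    using sets_eq_imp_space_eq[OF sets(1)] sets_eq_imp_space_eq[OF sets(2)] by auto
  define c where "c = measure \<mu> UNIV"
  have "char \<mu> 0 = char \<nu> 0" by (simp add: char)
  then have c': "measure \<nu> UNIV = c"
    by (simp add: char_def sp c_def)
  have em: "emeasure \<mu> UNIV = ennreal c" "emeasure \<nu> UNIV = ennreal c"
    using \<mu>.emeasure_eq_measure \<nu>.emeasure_eq_measure c' by (auto simp: c_def)
  show ?thesis
  proof (cases "c = 0")
    case True
    show ?thesis
    proof (rule measure_eqI)
      fix A assume "A \<in> sets \<mu>"
      then show "emeasure \<mu> A = emeasure \<nu> A"
        using emeasure_space[of \<mu> A] emeasure_space[of \<nu> A] em True by (simp add: sp)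
    qed (simp add: sets)
  next
    case False
    then have c: "c > 0" using measure_nonneg[of \<mu> UNIV] unfolding c_def by linarith
    have rd: "real_distribution (density m (\<lambda>_. ennreal (1 / c)))"
      if "sets m = sets borel" "emeasure m UNIV = ennreal c" for m
    proof (intro real_distribution.intro real_distribution_axioms.intro prob_spaceI)
      have "space m = UNIV" using sets_eq_imp_space_eq[OF that(1)] by simp
      then show "emeasure (density m (\<lambda>_. ennreal (1 / c))) (space (density m (\<lambda>_. ennreal (1 / c)))) = 1"
        using that c by (subst emeasure_density_const) (auto simp flip: ennreal_mult)
    qed (simp_all add: that(1) sets_eq_imp_space_eq[OF that(1)])
    have ch: "char (density m (\<lambda>_. ennreal (1 / c))) = (\<lambda>t. (1 / c) *\<^sub>R char m t)"
      if [measurable_cong]: "sets m = sets borel" for m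
    proof
      show "char (density m (\<lambda>_. ennreal (1 / c))) t = (1 / c) *\<^sub>R char m t" for t
        unfolding char_def using c by (subst integral_density) simp_all
    qed
    have "density \<mu> (\<lambda>_. ennreal (1 / c)) = density \<nu> (\<lambda>_. ennreal (1 / c))"
      by (intro Levy_uniqueness rd sets em) (simp only: ch sets char)
    then have d: "ennreal (1 / c) * emeasure \<mu> A = ennreal (1 / c) * emeasure \<nu> A" if "A \<in> sets borel" for A
      using that sets by (metis emeasure_density_const)
    show ?thesis
    proof (rule measure_eqI)
      fix A assume "A \<in> sets \<mu>"
      then have "A \<in> sets borel" using sets(1) by simp
      moreover have "ennreal (1 / c) \<noteq> 0" using c by simp
      ultimately show "emeasure \<mu> A = emeasure \<nu> A"
        using d[of A] ennreal_neq_top[of "1 / c"] unfolding ennreal_mult_cancel_left by blast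
    qed (simp add: sets)
  qed
qed

section \<open>Uniqueness theorem in several dimensions\<close>

definition mchar :: "'a::euclidean_space measure \<Rightarrow> 'a \<Rightarrow> complex" where
  "mchar M t = (CLINT x|M. iexp (t \<bullet> x))"

lemma iexp_add: "iexp (x + y) = iexp x * iexp y"
  by (simp add: distrib_left exp_add)

lemma integrable_indicator_iexp:
  assumes "finite_measure M" "A \<in> sets M" and [measurable]: "f \<in> borel_measurable M"
  shows "integrable M (\<lambda>x. indicator A x * iexp (f x))"
proof -
  interpret finite_measure M by fact
  show ?thesis
    using assms(2) by (intro integrable_const_bound[of _ 1]) (auto simp: indicator_def)
qed

text \<open>Induction over the coordinates: once the coordinates in \<open>B\<close> are localised in a box,
  the one-dimensional uniqueness theorem applies to the law of the coordinate \<open>j\<close> under the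
  weight \<open>1 + cos (t \<bullet> x + \<theta>)\<close>, which is nonnegative and whose Fourier transform is a
  combination of values of the given one.\<close>

lemma mchar_eq_imp_box_transform_eq:
  fixes M N :: "'a::euclidean_space measure"
  assumes fin: "finite_measure M" "finite_measure N"
    and sets[measurable_cong]: "sets M = sets borel" "sets N = sets borel"
    and eq: "\<And>t. mchar M t = mchar N t"
    and B: "finite B" "B \<subseteq> Basis"
  shows "(CLINT x|M. indicator {x. \<forall>i\<in>B. a \<bullet> i < x \<bullet> i \<and> x \<bullet> i < b \<bullet> i} x * iexp (t \<bullet> x))
       = (CLINT x|N. indicator {x. \<forall>i\<in>B. a \<bullet> i < x \<bullet> i \<and> x \<bullet> i < b \<bullet> i} x * iexp (t \<bullet> x))"
  using B
proof (induction B arbitrary: t rule: finite_induct)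
  case empty
  then show ?case using eq[of t] by (simp add: mchar_def)
next
  case (insert j B)
  define S where "S = {x. \<forall>i\<in>B. a \<bullet> i < x \<bullet> i \<and> x \<bullet> i < b \<bullet> i}"
  have S[measurable]: "S \<in> sets borel"
    unfolding S_def using \<open>finite B\<close> by measurable
  have IH: "(CLINT x|M. indicator S x * iexp (t \<bullet> x)) = (CLINT x|N. indicator S x * iexp (t \<bullet> x))" for t
    unfolding S_def using insert by auto
  \<comment> \<open>The summand \<open>1\<close> makes the weight nonnegative and is subtracted
    again at the end. The phase \<theta> allows both cosine and sine to be reached.\<close>
  define w where "w = (\<lambda>t \<theta> x. indicator S x * (1 + cos (t \<bullet> x + \<theta>)) :: real)"
  have w[measurable]: "w t \<theta> \<in> borel_measurable borel" for t \<theta>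
    unfolding w_def by measurable
  have wnn: "w t \<theta> x \<ge> 0" for t \<theta> x
  proof -
    have "0 \<le> 1 + cos (t \<bullet> x + \<theta>)" using cos_ge_minus_one[of "t \<bullet> x + \<theta>"] by linarith
    then show ?thesis by (simp add: w_def)
  qed
  have wle: "w t \<theta> x \<le> 2" for t \<theta> x
    using cos_le_one[of "t \<bullet> x + \<theta>"] by (simp add: w_def indicator_def)
  define \<mu> where "\<mu> = (\<lambda>m t \<theta>. distr (density m (w t \<theta>)) borel (\<lambda>x. x \<bullet> j))"
  have fin\<mu>: "finite_measure (\<mu> m t \<theta>)"
    if [measurable_cong]: "sets m = sets borel" and m: "finite_measure m" for m t \<theta>
  proof -
    interpret finite_measure m by fact
    have "integrable m (w t \<theta>)"
      using wnn wle by (intro integrable_const_bound[of _ 2]) auto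
    then have "(\<integral>\<^sup>+x. w t \<theta> x \<partial>m) < \<infinity>"
      using wnn by (auto simp: integrable_iff_bounded)
    then have "finite_measure (density m (w t \<theta>))"
      using sets_eq_imp_space_eq[OF that(1)]
      by (intro finite_measureI) (auto simp: emeasure_density simp flip: top.not_eq_extremum)
    then show ?thesis unfolding \<mu>_def
      by (rule finite_measure.finite_measure_distr) measurable
  qed
  \<comment> \<open>Writing the cosine as half the sum of two exponentials leaves only transforms
    localised to \<open>S\<close>, at the frequencies \<open>s j\<close>, \<open>s j + t\<close> and
    \<open>s j - t\<close>. The induction hypothesis covers all three since it holds for every
    frequency.\<close>
  have char\<mu>: "char (\<mu> m t \<theta>) s = (CLINT x|m. indicator S x * iexp ((s *\<^sub>R j) \<bullet> x))
      + (iexp \<theta> * (CLINT x|m. indicator S x * iexp ((s *\<^sub>R j + t) \<bullet> x))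
       + iexp (- \<theta>) * (CLINT x|m. indicator S x * iexp ((s *\<^sub>R j - t) \<bullet> x))) / 2"
    if [measurable_cong]: "sets m = sets borel" and m: "finite_measure m" for m t \<theta> s
  proof -
    have pt: "w t \<theta> x *\<^sub>R iexp (s * (x \<bullet> j)) = indicator S x * iexp ((s *\<^sub>R j) \<bullet> x)
      + (iexp \<theta> * (indicator S x * iexp ((s *\<^sub>R j + t) \<bullet> x))
       + iexp (- \<theta>) * (indicator S x * iexp ((s *\<^sub>R j - t) \<bullet> x))) / 2" for x
    proof -
      have "complex_of_real (cos (t \<bullet> x + \<theta>)) = (iexp (t \<bullet> x) * iexp \<theta> + iexp (- (t \<bullet> x)) * iexp (- \<theta>)) / 2"
      proof -
        have "complex_of_real (cos y) = (iexp y + iexp (- y)) / 2" for y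
          by (simp add: cos_exp_eq flip: cos_of_real)
        moreover have "- (t \<bullet> x + \<theta>) = - (t \<bullet> x) + (- \<theta>)" by simp
        ultimately show ?thesis by (simp only: iexp_add)
      qed
      moreover have "iexp ((s *\<^sub>R j + t) \<bullet> x) = iexp (s * (x \<bullet> j)) * iexp (t \<bullet> x)"
        "iexp ((s *\<^sub>R j - t) \<bullet> x) = iexp (s * (x \<bullet> j)) * iexp (- (t \<bullet> x))"
        by (simp_all add: inner_commute algebra_simps flip: exp_add)
      moreover have "iexp ((s *\<^sub>R j) \<bullet> x) = iexp (s * (x \<bullet> j))"
        by (simp add: inner_commute)
      ultimately show ?thesis
        unfolding w_def by (simp only: scaleR_conv_of_real of_real_mult of_real_add of_real_1)
          (simp add: indicator_def algebra_simps)
    qed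
    have "char (\<mu> m t \<theta>) s = (CLINT x|m. w t \<theta> x *\<^sub>R iexp (s * (x \<bullet> j)))"
      unfolding char_def \<mu>_def using wnn
      by (subst integral_distr) (auto intro!: integral_density)
    also have "\<dots> = (CLINT x|m. indicator S x * iexp ((s *\<^sub>R j) \<bullet> x))
      + (iexp \<theta> * (CLINT x|m. indicator S x * iexp ((s *\<^sub>R j + t) \<bullet> x))
       + iexp (- \<theta>) * (CLINT x|m. indicator S x * iexp ((s *\<^sub>R j - t) \<bullet> x))) / 2"
    proof -
      have I: "integrable m (\<lambda>x. indicator S x * iexp (u \<bullet> x))" for u
        using m by (rule integrable_indicator_iexp) auto
      show ?thesis
        unfolding pt using I
        by (simp only: Bochner_Integration.integral_add Bochner_Integration.integrable_add
            integrable_mult_right integrable_divide integral_divide_zero integral_mult_right_zero)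
    qed
    finally show ?thesis .
  qed
  have \<mu>eq: "\<mu> M t \<theta> = \<mu> N t \<theta>" for t \<theta>
  proof (rule char_eq_imp_eq_finite)
    show "char (\<mu> M t \<theta>) = char (\<mu> N t \<theta>)"
      using IH fin sets by (auto simp only: char\<mu> fun_eq_iff)
  qed (auto simp: fin\<mu> fin sets, auto simp: \<mu>_def)
  let ?I = "{a \<bullet> j<..<b \<bullet> j}"
  define S' where "S' = {x. \<forall>i\<in>insert j B. a \<bullet> i < x \<bullet> i \<and> x \<bullet> i < b \<bullet> i}"
  have S'[measurable]: "S' \<in> sets borel"
  proof -
    have "S' = S \<inter> {x. a \<bullet> j < x \<bullet> j \<and> x \<bullet> j < b \<bullet> j}" by (auto simp: S_def S'_def)
    also have "\<dots> \<in> sets borel" by measurable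
    finally show ?thesis .
  qed
  have ind: "indicator S' x = (indicator S x * indicator ?I (x \<bullet> j) :: real)" for x
    by (auto simp: S_def S'_def indicator_def)
  \<comment> \<open>Evaluating the law of coordinate \<open>j\<close> on the interval
    \<open>?I\<close> adds the missing constraint, turning \<open>S\<close> into
    \<open>S'\<close>.\<close>
  have meas: "(LINT y|\<mu> m t \<theta>. indicator ?I y) = (LINT x|m. indicator S' x * (1 + cos (t \<bullet> x + \<theta>)))"
    if [measurable_cong]: "sets m = sets borel" for m t \<theta>
  proof -
    have "(LINT y|\<mu> m t \<theta>. indicator ?I y :: real) = (LINT x|m. w t \<theta> x *\<^sub>R indicator ?I (x \<bullet> j))"
      unfolding \<mu>_def using wnn
      by (subst integral_distr) (auto simp: integral_density)
    then show ?thesis by (simp add: w_def ind mult_ac)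
  qed
  have split: "(LINT x|m. indicator S' x * (1 + cos (t \<bullet> x + \<theta>))) =
      (LINT x|m. indicator S' x) + (LINT x|m. indicator S' x * cos (t \<bullet> x + \<theta>))"
    if [measurable_cong]: "sets m = sets borel" and m: "finite_measure m" for m t \<theta>
  proof -
    interpret finite_measure m by fact
    have "integrable m (\<lambda>x. indicator S' x :: real)"
      by (intro integrable_const_bound[of _ 1]) (auto simp: indicator_def)
    moreover have "integrable m (\<lambda>x. indicator S' x * cos (t \<bullet> x + \<theta>))"
      by (intro integrable_const_bound[of _ 1]) (auto simp: indicator_def)
    ultimately show ?thesis by (simp add: distrib_left)
  qed
  have sum: "(LINT x|M. indicator S' x) + (LINT x|M. indicator S' x * cos (t \<bullet> x + \<theta>)) =
      (LINT x|N. indicator S' x) + (LINT x|N. indicator S' x * cos (t \<bullet> x + \<theta>))" for t \<theta>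
    using meas[OF sets(1), of t \<theta>] meas[OF sets(2), of t \<theta>] split[OF sets(1) fin(1), of t \<theta>]
      split[OF sets(2) fin(2), of t \<theta>] \<mu>eq[of t \<theta>] by simp
  \<comment> \<open>For \<open>t = 0\<close> and \<open>\<theta> = 0\<close> the cosine is
    \<open>1\<close>, so \<open>sum\<close> compares twice the masses of \<open>S'\<close>.
    Subtracting them isolates the cosine part.\<close>
  have "(LINT x|M. indicator S' x :: real) = (LINT x|N. indicator S' x)"
    using sum[of 0 0] by simp
  then have cos: "(LINT x|M. indicator S' x * cos (t \<bullet> x + \<theta>)) = (LINT x|N. indicator S' x * cos (t \<bullet> x + \<theta>))" for \<theta>
    using sum[of t \<theta>] by simp
  \<comment> \<open>The phase \<open>- pi / 2\<close> turns cosine into sine, hence real into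
    imaginary part.\<close>
  have ReIm: "Re (CLINT x|m. indicator S' x * iexp (t \<bullet> x)) = (LINT x|m. indicator S' x * cos (t \<bullet> x + 0))"
    "Im (CLINT x|m. indicator S' x * iexp (t \<bullet> x)) = (LINT x|m. indicator S' x * cos (t \<bullet> x + (- pi / 2)))"
    if [measurable_cong]: "sets m = sets borel" and m: "finite_measure m" for m
  proof -
    have I: "integrable m (\<lambda>x. indicator S' x * iexp (t \<bullet> x))"
      using m by (rule integrable_indicator_iexp) auto
    have ri: "Re (indicator S' x) = indicator S' x" "Im (indicator S' x) = 0" for x
      by (auto simp: indicator_def)
    have "cos (y + (- pi / 2)) = sin y" for y :: real
      by (simp add: cos_diff)
    then show "Re (CLINT x|m. indicator S' x * iexp (t \<bullet> x)) = (LINT x|m. indicator S' x * cos (t \<bullet> x + 0))"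
      "Im (CLINT x|m. indicator S' x * iexp (t \<bullet> x)) = (LINT x|m. indicator S' x * cos (t \<bullet> x + (- pi / 2)))"
      by (simp_all add: integral_Re[OF I, symmetric] integral_Im[OF I, symmetric] ri Re_exp Im_exp)
  qed
  show ?case unfolding S'_def[symmetric]
    using sets fin by (simp only: complex_eq_iff ReIm cos)
qed

text \<open>With every coordinate localised and frequency \<open>0\<close>, the box transforms are
  the measures of open boxes. These form an intersection-stable generator of the Borel sets and
  contain an exhausting sequence.\<close>

theorem mchar_uniqueness:
  fixes M N :: "'a::euclidean_space measure"
  assumes fin: "finite_measure M" "finite_measure N"
    and sets[measurable_cong]: "sets M = sets borel" "sets N = sets borel"
    and eq: "\<And>t. mchar M t = mchar N t"
  shows "M = N"
proof -
  interpret M: finite_measure M by fact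
  interpret N: finite_measure N by fact
  have box: "emeasure M (box a b) = emeasure N (box a b)" for a b
  proof -
    have "Re (indicator A x) = indicator A x" for A :: "'a set" and x
      by (simp add: indicator_def)
    then have "Re (CLINT x|m. indicator (box a b) x) = measure m (box a b)"
      if [measurable_cong]: "sets m = sets borel" and "finite_measure m" for m
      using integral_Re[OF integrable_indicator_iexp[OF that(2), of "box a b" "\<lambda>x. 0"]]
        sets_eq_imp_space_eq[OF that(1)] that(1) by simp
    moreover have "(CLINT x|M. indicator (box a b) x) = (CLINT x|N. indicator (box a b) x :: complex)"
      using mchar_eq_imp_box_transform_eq[OF fin sets eq finite_Basis subset_refl, of a b 0]
      by (simp add: box_def)
    ultimately have "measure M (box a b) = measure N (box a b)"
      using sets fin by metis
    then show ?thesis by (simp add: M.emeasure_eq_measure N.emeasure_eq_measure)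
  qed
  let ?E = "range (\<lambda>(a, b). box a b :: 'a set)"
  show ?thesis
  proof (rule measure_eqI_generator_eq)
    show "Int_stable ?E" by (auto simp: Int_stable_def box_Int_box)
    show "?E \<subseteq> Pow UNIV" "sets M = sigma_sets UNIV ?E" "sets N = sigma_sets UNIV ?E"
      by (simp_all add: sets borel_eq_box)
    let ?A = "\<lambda>n::nat. box (- (real n *\<^sub>R One)) (real n *\<^sub>R One) :: 'a set"
    show "range ?A \<subseteq> ?E" "(\<Union>i. ?A i) = UNIV"
      unfolding UN_box_eq_UNIV by auto
    show "emeasure M (?A i) \<noteq> \<infinity>" for i by simp
    show "emeasure M X = emeasure N X" if "X \<in> ?E" for X using that box by auto
  qed
qed

section \<open>Rules for computing the multivariate characteristic function\<close>

lemma mchar_distr: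
  assumes [measurable]: "X \<in> borel_measurable M"
  shows "mchar (distr M borel X) t = (CLINT \<omega>|M. iexp (t \<bullet> X \<omega>))"
  unfolding mchar_def by (subst integral_distr) auto

text \<open>Along a line, \<open>mchar\<close> is the characteristic function of a real projection;
  continuity on rays is inherited this way.\<close>

lemma mchar_scaleR:
  assumes [measurable_cong]: "sets M = sets borel"
  shows "mchar M (r *\<^sub>R t) = char (distr M borel (\<lambda>x. t \<bullet> x)) r"
  unfolding mchar_def char_def by (subst integral_distr) auto

lemma mchar_zero: "prob_space M \<Longrightarrow> mchar M 0 = 1"
  by (simp add: mchar_def prob_space.prob_space)

lemma tendsto_mchar_ray:
  assumes "prob_space M" and [measurable_cong]: "sets M = sets borel"
  shows "((\<lambda>r. mchar M (r *\<^sub>R t)) \<longlongrightarrow> mchar M (r0 *\<^sub>R t)) (at r0)"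
proof -
  interpret prob_space M by fact
  interpret D: real_distribution "distr M borel (\<lambda>x. t \<bullet> x)"
    by (rule real_distribution_distr) measurable
  show ?thesis
    using D.isCont_char[of r0] by (simp add: mchar_scaleR[OF assms(2)] isCont_def)
qed

text \<open>Continuity on the ray and the value \<open>1\<close> at the origin. This supplies the
  nonvanishing noise factors for \<open>entire_factorization_eq\<close>.\<close>

lemma eventually_mchar_ray_nonzero:
  assumes "prob_space M" "sets M = sets borel"
  shows "eventually (\<lambda>r. mchar M (r *\<^sub>R t) \<noteq> 0) (nhds 0)"
proof -
  have "((\<lambda>r. mchar M (r *\<^sub>R t)) \<longlongrightarrow> 1) (at 0)"
    using tendsto_mchar_ray[OF assms, of t 0] mchar_zero[OF assms(1)] by simp
  then have "eventually (\<lambda>r. mchar M (r *\<^sub>R t) \<noteq> 0) (at 0)"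
    by (rule tendsto_imp_eventually_ne) simp
  then show ?thesis
    using mchar_zero[OF assms(1)] by (simp add: eventually_nhds_conv_at)
qed

lemma mchar_convolution:
  fixes P Q :: "'a::ordered_euclidean_space measure"
  assumes "prob_space P" "prob_space Q"
    and [measurable_cong]: "sets P = sets borel" "sets Q = sets borel"
  shows "mchar (P \<star> Q) t = mchar P t * mchar Q t"
proof -
  interpret P: prob_space P by fact
  interpret Q: prob_space Q by fact
  interpret PQ: pair_prob_space P Q ..
  have E: "iexp (t \<bullet> (x + y)) = iexp (t \<bullet> x) * iexp (t \<bullet> y)" for x y
    by (simp add: inner_add_right distrib_left exp_add)
  have "mchar (P \<star> Q) t = (CLINT z|P \<Otimes>\<^sub>M Q. iexp (t \<bullet> (case z of (x, y) \<Rightarrow> x + y)))"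
    unfolding mchar_def convolution_def by (rule integral_distr) measurable
  also have "\<dots> = (CLINT z|P \<Otimes>\<^sub>M Q. (case z of (x, y) \<Rightarrow> iexp (t \<bullet> x) * iexp (t \<bullet> y)))"
    by (simp only: split_beta E)
  also have "\<dots> = (CLINT x|P. (CLINT y|Q. iexp (t \<bullet> x) * iexp (t \<bullet> y)))"
  proof (rule PQ.integral_fst[symmetric])
    show "integrable (P \<Otimes>\<^sub>M Q) (\<lambda>(x, y). iexp (t \<bullet> x) * iexp (t \<bullet> y))"
    proof (rule PQ.P.integrable_const_bound[of _ 1])
      show "AE z in P \<Otimes>\<^sub>M Q. norm (case z of (x, y) \<Rightarrow> iexp (t \<bullet> x) * iexp (t \<bullet> y)) \<le> 1"
        by (rule AE_I2) (simp add: split_beta norm_mult)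
    qed measurable
  qed
  also have "\<dots> = mchar P t * mchar Q t"
    by (simp add: mchar_def)
  finally show ?thesis .
qed

lemma mchar_indep_pair:
  fixes \<epsilon> :: "'s \<Rightarrow> 'a::euclidean_space \<times> 'a"
  assumes "prob_space N" and [measurable]: "\<epsilon> \<in> borel_measurable N"
    and indep: "prob_space.indep_var N borel (\<lambda>\<omega>. fst (\<epsilon> \<omega>)) borel (\<lambda>\<omega>. snd (\<epsilon> \<omega>))"
  shows "mchar (distr N borel \<epsilon>) (s, t) =
    mchar (distr N borel (\<lambda>\<omega>. fst (\<epsilon> \<omega>))) s * mchar (distr N borel (\<lambda>\<omega>. snd (\<epsilon> \<omega>))) t"
proof -
  interpret prob_space N by fact
  have m[measurable]: "(\<lambda>\<omega>. fst (\<epsilon> \<omega>)) \<in> borel_measurable N" "(\<lambda>\<omega>. snd (\<epsilon> \<omega>)) \<in> borel_measurable N"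
    using indep by (auto dest: indep_var_rv1 indep_var_rv2)
  have "indep_var borel ((\<lambda>x. iexp (s \<bullet> x)) \<circ> (\<lambda>\<omega>. fst (\<epsilon> \<omega>))) borel ((\<lambda>x. iexp (t \<bullet> x)) \<circ> (\<lambda>\<omega>. snd (\<epsilon> \<omega>)))"
    by (rule indep_var_compose[OF indep]) measurable
  then have "(CLINT \<omega>|N. iexp (s \<bullet> fst (\<epsilon> \<omega>)) * iexp (t \<bullet> snd (\<epsilon> \<omega>)))
    = (CLINT \<omega>|N. iexp (s \<bullet> fst (\<epsilon> \<omega>))) * (CLINT \<omega>|N. iexp (t \<bullet> snd (\<epsilon> \<omega>)))"
    by (intro indep_var_lebesgue_integral) (auto simp: comp_def intro!: integrable_const_bound[of _ 1])
  moreover have "iexp ((s, t) \<bullet> \<epsilon> \<omega>) = iexp (s \<bullet> fst (\<epsilon> \<omega>)) * iexp (t \<bullet> snd (\<epsilon> \<omega>))" for \<omega>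
    by (simp add: inner_prod_def distrib_left exp_add)
  ultimately show ?thesis by (simp only: mchar_distr m assms(2))
qed

lemma mchar_translate:
  assumes [measurable]: "X \<in> borel_measurable M"
  shows "mchar (distr M borel (\<lambda>\<omega>. X \<omega> + v)) t = mchar (distr M borel X) t * iexp (t \<bullet> v)"
  by (simp add: mchar_distr inner_add_right distrib_left exp_add)

text \<open>Both components carry the same vector, so the frequencies add up: the signal enters only
  through \<open>s + t\<close>.\<close>

lemma mchar_repeat_map:
  assumes [measurable]: "X \<in> borel_measurable M"
  shows "mchar (distr M borel (\<lambda>\<omega>. repeat_map (X \<omega>))) (s, t) = mchar (distr M borel X) (s + t)"
  by (simp add: repeat_map_def mchar_distr inner_add_left)

lemma mchar_repeat_map_convolution:
  fixes X :: "'s \<Rightarrow> 'a::ordered_euclidean_space"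
  assumes prob: "prob_space M" "prob_space N"
    and X[measurable]: "X \<in> borel_measurable M" and \<epsilon>[measurable]: "\<epsilon> \<in> borel_measurable N"
  shows "mchar (distr M borel (\<lambda>\<omega>. repeat_map (X \<omega>)) \<star> distr N borel \<epsilon>) (s, t) =
    mchar (distr M borel X) (s + t) * mchar (distr N borel \<epsilon>) (s, t)"
proof -
  have "(\<lambda>\<omega>. repeat_map (X \<omega>)) \<in> borel_measurable M"
    unfolding repeat_map_def by measurable
  then have "mchar (distr M borel (\<lambda>\<omega>. repeat_map (X \<omega>)) \<star> distr N borel \<epsilon>) (s, t) =
      mchar (distr M borel (\<lambda>\<omega>. repeat_map (X \<omega>))) (s, t) * mchar (distr N borel \<epsilon>) (s, t)"
    using prob \<epsilon> by (intro mchar_convolution prob_space.prob_space_distr) auto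
  then show ?thesis by (simp only: mchar_repeat_map X)
qed

text \<open>The sum over \<open>Basis\<close> is the mean vector, assembled from scalar
  integrals.\<close>

lemma expectation_inner_left:
  fixes X :: "'s \<Rightarrow> 'a::euclidean_space"
  assumes "\<And>u. integrable M (\<lambda>\<omega>. u \<bullet> X \<omega>)"
  shows "(LINT \<omega>|M. u \<bullet> X \<omega>) = u \<bullet> (\<Sum>i\<in>Basis. (LINT \<omega>|M. i \<bullet> X \<omega>) *\<^sub>R i)"
proof -
  have "u \<bullet> X \<omega> = (\<Sum>i\<in>Basis. (u \<bullet> i) * (i \<bullet> X \<omega>))" for \<omega>
    by (subst euclidean_inner) (simp add: inner_commute)
  then show ?thesis
    using assms by (simp add: inner_sum_right mult.commute)
qed

section \<open>Identifiability\<close>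

theorem theorem1:
  fixes M :: "'s measure" and M' :: "'t measure"
    and N :: "'u measure" and N' :: "'w measure"
    and X :: "'s \<Rightarrow> real ^ 'd" and X' :: "'t \<Rightarrow> real ^ 'd"
    and \<epsilon> :: "'u \<Rightarrow> (real ^ 'd) \<times> (real ^ 'd)"
    and \<epsilon>' :: "'w \<Rightarrow> (real ^ 'd) \<times> (real ^ 'd)"
    and Q Q' :: "((real ^ 'd) \<times> (real ^ 'd)) measure"
  assumes "prob_space M" and "prob_space M'" and "prob_space N" and "prob_space N'"
    and "X \<in> borel_measurable M" and "X' \<in> borel_measurable M'"
    and "\<epsilon> \<in> borel_measurable N" and "\<epsilon>' \<in> borel_measurable N'"
    and "laplace_order_bounded M X" and "laplace_order_bounded M' X'"
    and "prob_space.indep_var N borel (\<lambda>\<omega>. fst (\<epsilon> \<omega>)) borel (\<lambda>\<omega>. snd (\<epsilon> \<omega>))"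
    and "prob_space.indep_var N' borel (\<lambda>\<omega>. fst (\<epsilon>' \<omega>)) borel (\<lambda>\<omega>. snd (\<epsilon>' \<omega>))"
    and "Q = distr N borel \<epsilon>" and "Q' = distr N' borel \<epsilon>'"
    and "(distr M borel (\<lambda>\<omega>. repeat_map (X \<omega>)) \<star> Q)
       = (distr M' borel (\<lambda>\<omega>. repeat_map (X' \<omega>)) \<star> Q')"
  shows "\<exists>m :: real ^ 'd.
      distr M' borel X' = distr M borel (\<lambda>\<omega>. X \<omega> + m) \<and>
      Q' = distr N borel (\<lambda>\<omega>. \<epsilon> \<omega> - (m, m))"
proof -
  interpret M: prob_space M by fact
  interpret M': prob_space M' by fact
  interpret N: prob_space N by fact
  interpret N': prob_space N' by fact
  note [measurable] = assms(5-8)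
  have [measurable]: "(\<lambda>\<omega>. fst (\<epsilon> \<omega>)) \<in> borel_measurable N" "(\<lambda>\<omega>. snd (\<epsilon> \<omega>)) \<in> borel_measurable N"
    "(\<lambda>\<omega>. fst (\<epsilon>' \<omega>)) \<in> borel_measurable N'" "(\<lambda>\<omega>. snd (\<epsilon>' \<omega>)) \<in> borel_measurable N'"
    using assms(11,12) N.indep_var_rv1 N.indep_var_rv2 N'.indep_var_rv1 N'.indep_var_rv2 by blast+
  define P where "P = distr M borel X"
  define P' where "P' = distr M' borel X'"
  \<comment> \<open>For each direction \<open>u\<close>, the entire extension of the characteristic
    function of \<open>X\<close> along the line spanned by \<open>u\<close>.\<close>
  define \<phi> where "\<phi> = (\<lambda>u z. CLINT \<omega>|M. exp (\<i> * z * of_real (u \<bullet> X \<omega>)))"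
  define \<phi>' where "\<phi>' = (\<lambda>u z. CLINT \<omega>|M'. exp (\<i> * z * of_real (u \<bullet> X' \<omega>)))"
  \<comment> \<open>The difference of the means is the only possible shift, since translating by
    \<open>m\<close> moves the mean by \<open>m\<close>.\<close>
  define m where "m = (\<Sum>i\<in>Basis. (LINT \<omega>|M'. i \<bullet> X' \<omega>) *\<^sub>R i) - (\<Sum>i\<in>Basis. (LINT \<omega>|M. i \<bullet> X \<omega>) *\<^sub>R i)"
  note prob = M.prob_space_distr M'.prob_space_distr N.prob_space_distr N'.prob_space_distr
  have key: "mchar P (s + t) * mchar Q (s, t) = mchar P' (s + t) * mchar Q' (s, t)" for s t
    using arg_cong[OF assms(15), of "\<lambda>R. mchar R (s, t)"] unfolding assms(13,14) P_def P'_def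
    by (simp only: mchar_repeat_map_convolution assms(1-8))
  have "integrable M (\<lambda>\<omega>. exp ((l *\<^sub>R u) \<bullet> X \<omega>))" "integrable M' (\<lambda>\<omega>. exp ((l *\<^sub>R u) \<bullet> X' \<omega>))" for l u
    using assms(9,10) unfolding laplace_order_bounded_def by blast+
  then have int: "integrable M (\<lambda>\<omega>. exp (l * (u \<bullet> X \<omega>)))" "integrable M' (\<lambda>\<omega>. exp (l * (u \<bullet> X' \<omega>)))" for l u
    by simp_all
  have holo: "\<phi> u holomorphic_on UNIV" "\<phi>' u holomorphic_on UNIV" for u
    unfolding \<phi>_def \<phi>'_def using int
    by (auto intro!: holomorphic_complex_mgf M.finite_measure M'.finite_measure)
  have one: "\<phi> u 0 = 1" "\<phi>' u 0 = 1" for u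
    by (simp_all add: \<phi>_def \<phi>'_def M.prob_space M'.prob_space)
  have \<phi>_real: "\<phi> u (of_real r) = mchar P (r *\<^sub>R u)" "\<phi>' u (of_real r) = mchar P' (r *\<^sub>R u)" for u r
    by (simp_all add: \<phi>_def \<phi>'_def P_def P'_def mchar_distr mult_ac)
  have intX: "integrable M (\<lambda>\<omega>. u \<bullet> X \<omega>)" "integrable M' (\<lambda>\<omega>. u \<bullet> X' \<omega>)" for u
    by (rule integrable_if_exp_moments; use int in \<open>auto intro: M.finite_measure M'.finite_measure\<close>)+
  \<comment> \<open>The exponent found on each line is linear in the direction \<open>u\<close>, so
    a single vector \<open>m\<close> serves all lines.\<close>
  have der: "deriv (\<phi>' u) 0 - deriv (\<phi> u) 0 = \<i> * of_real (u \<bullet> m)" for u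
  proof -
    have "deriv (\<phi> u) 0 = \<i> * of_real (LINT \<omega>|M. u \<bullet> X \<omega>)" "deriv (\<phi>' u) 0 = \<i> * of_real (LINT \<omega>|M'. u \<bullet> X' \<omega>)"
      unfolding \<phi>_def \<phi>'_def
      by (rule deriv_complex_mgf; simp add: int M.finite_measure_axioms M'.finite_measure_axioms)+
    then show ?thesis
      unfolding expectation_inner_left[OF intX(1), of u] expectation_inner_left[OF intX(2), of u] m_def
      by (simp only: inner_diff_right of_real_diff right_diff_distrib)
  qed
  have \<phi>_eq: "\<phi>' u z = \<phi> u z * exp (\<i> * of_real (u \<bullet> m) * z)" for u z
    unfolding der[symmetric]
  proof (rule entire_factorization_eq)
    define \<alpha> \<beta> \<alpha>' \<beta>' where "\<alpha> = mchar (distr N borel (\<lambda>\<omega>. fst (\<epsilon> \<omega>)))"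
      and "\<beta> = mchar (distr N borel (\<lambda>\<omega>. snd (\<epsilon> \<omega>)))"
      and "\<alpha>' = mchar (distr N' borel (\<lambda>\<omega>. fst (\<epsilon>' \<omega>)))"
      and "\<beta>' = mchar (distr N' borel (\<lambda>\<omega>. snd (\<epsilon>' \<omega>)))"
    note defs = \<alpha>_def \<beta>_def \<alpha>'_def \<beta>'_def
    show "eventually (\<lambda>s. \<alpha> (s *\<^sub>R u) \<noteq> 0 \<and> \<beta> (s *\<^sub>R u) \<noteq> 0 \<and> \<alpha>' (s *\<^sub>R u) \<noteq> 0 \<and> \<beta>' (s *\<^sub>R u) \<noteq> 0) (nhds 0)"
      unfolding defs by (intro eventually_conj eventually_mchar_ray_nonzero prob) auto
    show "\<alpha> (0 *\<^sub>R u) = 1" "\<beta> (0 *\<^sub>R u) = 1" "\<alpha>' (0 *\<^sub>R u) = 1" "\<beta>' (0 *\<^sub>R u) = 1"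
      by (simp_all add: defs mchar_zero prob)
    fix s t :: real
    have "mchar Q (s *\<^sub>R u, t *\<^sub>R u) = \<alpha> (s *\<^sub>R u) * \<beta> (t *\<^sub>R u)"
      "mchar Q' (s *\<^sub>R u, t *\<^sub>R u) = \<alpha>' (s *\<^sub>R u) * \<beta>' (t *\<^sub>R u)"
      unfolding assms(13,14) defs using assms(3,4,7,8,11,12) by (auto intro!: mchar_indep_pair)
    then show "\<phi> u (of_real (s + t)) * \<alpha> (s *\<^sub>R u) * \<beta> (t *\<^sub>R u)
      = \<phi>' u (of_real (s + t)) * \<alpha>' (s *\<^sub>R u) * \<beta>' (t *\<^sub>R u)"
      using key[of "s *\<^sub>R u" "t *\<^sub>R u"] by (simp only: \<phi>_real scaleR_add_left mult.assoc)
  qed (use holo one in auto)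
  have P'_eq: "mchar P' u = mchar P u * iexp (u \<bullet> m)" for u
    using \<phi>_eq[of u 1] \<phi>_real[of u 1] by simp
  \<comment> \<open>The factor \<open>mchar P (s + t)\<close> may vanish, so it cannot simply be
    cancelled. If the identity failed at \<open>(s, t)\<close>, continuity would make it fail on the
    ray for all \<open>r\<close> near \<open>1\<close>. Then \<open>\<phi> (s + t)\<close> would
    vanish at all such \<open>r\<close> other than possibly \<open>1\<close>, hence identically,
    contradicting its value \<open>1\<close> at \<open>0\<close>.\<close>
  have Q'_eq: "mchar Q' (s, t) = mchar Q (s, t) * iexp ((s, t) \<bullet> - (m, m))" for s t
  proof (rule ccontr)
    let ?v = "s + t" and ?w = "(s, t)"
    \<comment> \<open>The cofactor of \<open>mchar P (r *\<^sub>R ?v)\<close> once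
      \<open>P'_eq\<close> is substituted into \<open>key\<close> at the point
      \<open>r *\<^sub>R ?w\<close>.\<close>
    let ?D = "\<lambda>r. mchar Q (r *\<^sub>R ?w) - iexp (r * (?v \<bullet> m)) * mchar Q' (r *\<^sub>R ?w)"
    assume neq: "mchar Q' (s, t) \<noteq> mchar Q (s, t) * iexp ((s, t) \<bullet> - (m, m))"
    have "?D 1 \<noteq> 0"
    proof
      assume "?D 1 = 0"
      then have "mchar Q (s, t) * iexp ((s, t) \<bullet> - (m, m)) = iexp (?v \<bullet> m + (s, t) \<bullet> - (m, m)) * mchar Q' (s, t)"
        \<comment> \<open>The exponent on the right is zero because
          \<open>(s, t) \<bullet> (m, m) = (s + t) \<bullet> m\<close>, which yields the
          contradiction.\<close>
        unfolding iexp_add by simp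
      with neq show False by (simp add: inner_add_left)
    qed
    moreover have "(?D \<longlongrightarrow> ?D 1) (at 1)"
      unfolding assms(13,14)
      by (intro tendsto_intros tendsto_mchar_ray prob) auto
    ultimately have "eventually (\<lambda>r. ?D r \<noteq> 0) (at 1)"
      by (rule tendsto_imp_eventually_ne[rotated])
    then have "eventually (\<lambda>r. \<phi> ?v (of_real r) = 0) (at 1)"
    proof eventually_elim
      case (elim r)
      have "mchar P (r *\<^sub>R ?v) * ?D r = 0"
        using key[of "r *\<^sub>R s" "r *\<^sub>R t"] P'_eq[of "r *\<^sub>R ?v"]
        by (simp add: scaleR_add_right algebra_simps)
      with elim show ?case by (simp add: \<phi>_real)
    qed
    then have "\<phi> ?v 0 = 0" by (rule holomorphic_eq_zero_if_zero_on_reals[OF holo(1)])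
    then show False by (simp add: one)
  qed
  have "P' = distr M borel (\<lambda>\<omega>. X \<omega> + m)"
    unfolding P'_def
  proof (rule mchar_uniqueness)
    show "mchar (distr M' borel X') u = mchar (distr M borel (\<lambda>\<omega>. X \<omega> + m)) u" for u
      using P'_eq[of u] by (simp add: mchar_translate P_def P'_def)
  qed (auto intro!: prob_space.finite_measure prob)
  moreover have "Q' = distr N borel (\<lambda>\<omega>. \<epsilon> \<omega> + - (m, m))"
    unfolding assms(14)
  proof (rule mchar_uniqueness)
    show "mchar (distr N' borel \<epsilon>') u = mchar (distr N borel (\<lambda>\<omega>. \<epsilon> \<omega> + - (m, m))) u" for u
      using Q'_eq[of "fst u" "snd u"] by (simp only: mchar_translate assms(7,13,14) prod.collapse)
  qed (auto intro!: prob_space.finite_measure prob)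
  ultimately show ?thesis unfolding P'_def by (intro exI[of _ m]) (simp only: diff_conv_add_uminus)
qed

end
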